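(* Let $X$ be a real Hilbert space, let $A$ and $B$ be closed convex subsets of $X$ with $A\cap B\neq\varnothing$, and let $z\in X$. Let $(a_n)_{n\ge 1}$, $(b_n)_{n\ge 0}$ be the main sequences of Dykstra's algorithm for $(A,B,z)$, and let $(c_n)_{n\ge 0}$ be the MAP sequence with $c_0=z$. Suppose that one of the following holds: (i) $z-P_A(z)\in N_A(P_B(P_A(z)))$; (ii) $A$ is an affine subspace and $P_B(P_A(z))\in A$. Then $P_{A\cap B}(z)=P_B(P_A(z))=b_1=a_2=b_2=a_3=b_3=\cdots$, i.e. $b_n=P_{A\cap B}(z)=P_B(P_A(z))$ for all $n\ge 1$ and $a_n=P_{A\cap B}(z)$ for all $n\geq 2$. Moreover, the main sequences of MAP and Dykstra's algorithm fully coincide: $c_{2n-1}=a_n$ and $c_{2n}=b_n$ for all $n\ge 1$.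
   Context: For a nonempty closed convex set $C\subseteq X$, $P_C$ denotes the (nearest point) projection onto $C$. The normal cone of $C$ at $x$ is $N_C(x)=\{y\in X : \langle y,c-x\rangle\le 0 \text{ for all } c\in C\}$ if $x\in C$, and $N_C(x)=\varnothing$ if $x\notin C$. Dykstra's algorithm for $(A,B,z)$: set $b_0=z$, $p_0=0$, $q_0=0$ and for $n\ge 1$ $a_n=P_A(b_{n-1}+p_{n-1})$, $p_n=b_{n-1}+p_{n-1}-a_n$, $b_n=P_B(a_n+q_{n-1})$, $q_n=a_n+q_{n-1}-b_n$. The sequences $(a_n)$ and $(b_n)$ are the main sequences; $(p_n)$ and $(q_n)$ are the auxiliary sequences. Method of alternating projections (MAP): $c_0=z$, and $c_{2n-1}=P_A(c_{2n-2})$, $c_{2n}=P_B(c_{2n-1})$ for $n\ge 1$. *)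

theory Defs
  imports "HOL-Analysis.Analysis"
begin

(* The library's closest_point is restricted to the sort {real_inner, heine_borel}, which
   excludes infinite-dimensional Hilbert spaces; this is the same definition without heine_borel.
   In a Hilbert space the nearest point exists and is unique when C is nonempty, closed and convex;
   for other C the value need not be meaningful. *)
definition proj_onto :: "'a::real_inner set \<Rightarrow> 'a \<Rightarrow> 'a"
  where "proj_onto C x = (SOME u. u \<in> C \<and> (\<forall>y\<in>C. dist x u \<le> dist x y))"

definition normal_cone :: "'a::real_inner set \<Rightarrow> 'a \<Rightarrow> 'a set"
  where "normal_cone C x = (if x \<in> C then {y. \<forall>c\<in>C. inner y (c - x) \<le> 0} else {})"

(* The main sequence a starts at index 1: a 0 is left unconstrained. *)
definition dykstra_seqs ::
  "'a::real_inner set \<Rightarrow> 'a set \<Rightarrow> 'a \<Rightarrow>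
     (nat \<Rightarrow> 'a) \<Rightarrow> (nat \<Rightarrow> 'a) \<Rightarrow> (nat \<Rightarrow> 'a) \<Rightarrow> (nat \<Rightarrow> 'a) \<Rightarrow> bool"
  where "dykstra_seqs A B z a b p q \<longleftrightarrow>
    b 0 = z \<and> p 0 = 0 \<and> q 0 = 0 \<and>
    (\<forall>n\<ge>1.
       a n = proj_onto A (b (n - 1) + p (n - 1)) \<and>
       p n = b (n - 1) + p (n - 1) - a n \<and>
       b n = proj_onto B (a n + q (n - 1)) \<and>
       q n = a n + q (n - 1) - b n)"

definition map_seq :: "'a::real_inner set \<Rightarrow> 'a set \<Rightarrow> 'a \<Rightarrow> (nat \<Rightarrow> 'a) \<Rightarrow> bool"
  where "map_seq A B z c \<longleftrightarrow>
    c 0 = z \<and>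
    (\<forall>n\<ge>1.
       c (2 * n - 1) = proj_onto A (c (2 * n - 2)) \<and>
       c (2 * n) = proj_onto B (c (2 * n - 1)))"

end

theory Submission
  imports Defs
begin

text \<open>By the variational characterisation, \<open>P\<^sub>C x = u\<close> iff \<open>x - u\<close> lies in the normal cone of \<open>C\<close> at \<open>u\<close>.
  Put \<open>x = P\<^sub>B (P\<^sub>A z)\<close>. Each of the two conditions gives \<open>p\<^sub>1 = z - P\<^sub>A z \<in> N\<^sub>A(x)\<close> (under (ii) since \<open>p\<^sub>1\<close> is
  orthogonal to \<open>A - A\<close>), and \<open>q\<^sub>1 = P\<^sub>A z - x \<in> N\<^sub>B(x)\<close> always. Hence \<open>z - x = p\<^sub>1 + q\<^sub>1\<close> is normal to
  \<open>A \<inter> B\<close> at \<open>x\<close>, and \<open>x + p\<^sub>1\<close>, \<open>x + q\<^sub>1\<close> are projected back to \<open>x\<close> by \<open>P\<^sub>A\<close> and \<open>P\<^sub>B\<close>, so Dykstra's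
  iteration is stationary from the first step on.\<close>

text \<open>Completeness replaces compactness: the nested closed sets \<open>S n\<close> of almost
  nearest points have diameters tending to 0, so Cantor's intersection principle yields a common
  point.\<close>

lemma nearest_point_exists:
  fixes C :: "'a::{real_inner, complete_space} set"
  assumes "closed C" "convex C" "C \<noteq> {}"
  obtains u where "u \<in> C" "\<And>y. y \<in> C \<Longrightarrow> dist x u \<le> dist x y"
proof -
  define d where "d = infdist x C"
  \<comment> \<open>The squared radius exceeds \<open>d\<^sup>2\<close> by exactly
    \<open>1 / real (Suc n)\<close>, the quantity that the parallelogram law below turns into a
    diameter bound.\<close>
  define r where "r n = sqrt (d\<^sup>2 + 1 / real (Suc n))" for n
  define S where "S n = C \<inter> cball x (r n)" for n
  have d0: "0 \<le> d" by (simp add: d_def infdist_nonneg)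
  have dle: "d \<le> dist x y" if "y \<in> C" for y
    using that by (simp add: d_def infdist_le)
  have r0: "0 \<le> r n" for n by (simp add: r_def)
  have r2: "(r n)\<^sup>2 = d\<^sup>2 + 1 / real (Suc n)" for n
    by (simp add: r_def)
  have dr: "d < r n" for n
    by (rule power2_less_imp_less) (simp_all add: r2 r0)
  have "\<exists>u. \<forall>n. u \<in> S n"
  proof (rule decreasing_closed_nest)
    show "closed (S n)" for n using assms by (auto simp: S_def)
    show "S n \<noteq> {}" for n
    proof -
      have "\<exists>y\<in>C. dist x y < r n"
        using dr[of n] assms(3) by (auto simp: d_def infdist_def cINF_less_iff)
      then show ?thesis by (force simp: S_def)
    qed
    show "S n \<subseteq> S m" if "m \<le> n" for m n
    proof -
      have "r n \<le> r m"
        using that by (simp add: r_def frac_le)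
      then show ?thesis by (auto simp: S_def)
    qed
    show "\<exists>n. \<forall>u\<in>S n. \<forall>v\<in>S n. dist u v < e" if "0 < e" for e
    proof -
      have "0 < e\<^sup>2 / 4" using that by simp
      then obtain n where n: "1 / real (Suc n) < e\<^sup>2 / 4"
        using nat_approx_posE by metis
      have "dist u v < e" if "u \<in> S n" "v \<in> S n" for u v
      proof (rule power2_less_imp_less)
        let ?m = "(1/2) *\<^sub>R u + (1/2) *\<^sub>R v"
        have uv: "u \<in> C" "v \<in> C" "dist x u \<le> r n" "dist x v \<le> r n"
          using that by (auto simp: S_def)
        have "?m \<in> C" using assms(2) uv by (auto intro: convexD)
        then have "d\<^sup>2 \<le> (dist x ?m)\<^sup>2" using d0 dle by (simp add: power_mono)
        moreover have "(dist x u)\<^sup>2 \<le> (r n)\<^sup>2" "(dist x v)\<^sup>2 \<le> (r n)\<^sup>2"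
          using uv by (simp_all add: power_mono)
        \<comment> \<open>Parallelogram law: since the midpoint is at distance at least
          \<open>d\<close> from \<open>x\<close>, the right side is at most
          \<open>4 / real (Suc n)\<close>.\<close>
        moreover have "(dist u v)\<^sup>2 = 2 * (dist x u)\<^sup>2 + 2 * (dist x v)\<^sup>2 - 4 * (dist x ?m)\<^sup>2"
          by (simp add: dist_norm power2_norm_eq_inner inner_simps inner_commute algebra_simps)
        ultimately show "(dist u v)\<^sup>2 < e\<^sup>2" using n r2[of n] by linarith
      qed (use \<open>0 < e\<close> in simp)
      then show ?thesis by blast
    qed
  qed blast
  then obtain u where u: "\<And>n. u \<in> S n" by blast
  have "(dist x u)\<^sup>2 \<le> d\<^sup>2 + e" if "0 < e" for e
  proof -
    obtain n where "1 / real (Suc n) < e" using \<open>0 < e\<close> nat_approx_posE by metis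
    moreover have "(dist x u)\<^sup>2 \<le> (r n)\<^sup>2"
      using u[of n] by (simp add: S_def power_mono)
    ultimately show ?thesis using r2[of n] by linarith
  qed
  then have "dist x u \<le> d"
    using d0 by (metis field_le_epsilon power2_le_imp_le)
  moreover have "u \<in> C" using u[of 0] by (simp add: S_def)
  ultimately show thesis using that dle by (meson order_trans)
qed

text \<open>The obtuse angle at \<open>u\<close> gives the Pythagorean inequality
  \<open>far\<close>, which yields both minimality and uniqueness of \<open>u\<close>, so the choice
  in \<open>proj_onto\<close> is forced.\<close>

lemma proj_onto_eqI:
  fixes C :: "'a::real_inner set"
  assumes "x - u \<in> normal_cone C u"
  shows "proj_onto C x = u"
proof -
  have u: "u \<in> C" and dot: "\<And>y. y \<in> C \<Longrightarrow> inner (x - u) (y - u) \<le> 0"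
    using assms by (auto simp: normal_cone_def split: if_splits)
  have far: "(dist x u)\<^sup>2 + (dist u y)\<^sup>2 \<le> (dist x y)\<^sup>2" if "y \<in> C" for y
    using dot[OF that]
    by (simp add: dist_norm power2_norm_eq_inner inner_simps inner_commute algebra_simps)
  show ?thesis
    unfolding proj_onto_def
  proof (rule some_equality)
    show "u \<in> C \<and> (\<forall>y\<in>C. dist x u \<le> dist x y)"
      using u far by (smt (verit) power2_le_imp_le zero_le_dist zero_le_power2)
    fix v assume v: "v \<in> C \<and> (\<forall>y\<in>C. dist x v \<le> dist x y)"
    then have "(dist x v)\<^sup>2 \<le> (dist x u)\<^sup>2" using u by (simp add: power_mono)
    with far[OF conjunct1[OF v]] have "(dist u v)\<^sup>2 \<le> 0" by linarith
    then show "v = u" by simp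
  qed
qed

lemma proj_onto_normal:
  fixes C :: "'a::{real_inner, complete_space} set"
  assumes "closed C" "convex C" "C \<noteq> {}"
  shows "x - proj_onto C x \<in> normal_cone C (proj_onto C x)"
proof -
  have "\<exists>u. u \<in> C \<and> (\<forall>y\<in>C. dist x u \<le> dist x y)"
    using nearest_point_exists[OF assms] by metis
  then have "proj_onto C x \<in> C \<and> (\<forall>y\<in>C. dist x (proj_onto C x) \<le> dist x y)"
    unfolding proj_onto_def by (rule someI_ex)
  then show ?thesis
    using any_closest_point_dot[OF assms(2,1)] by (auto simp: normal_cone_def)
qed

text \<open>Directions \<open>y - x\<close> within an affine set can be attached at any of its
  points, so the inequality at \<open>u\<close> transfers to \<open>x\<close>. This serves condition
  (ii).\<close>

lemma normal_cone_affine: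
  fixes A :: "'a::real_inner set"
  assumes "affine A" "w \<in> normal_cone A u" "x \<in> A"
  shows "w \<in> normal_cone A x"
proof -
  have u: "u \<in> A" and dot: "\<And>y. y \<in> A \<Longrightarrow> inner w (y - u) \<le> 0"
    using assms(2) by (auto simp: normal_cone_def split: if_splits)
  have "inner w (y - x) \<le> 0" if "y \<in> A" for y
  proof -
    have "u + 1 *\<^sub>R (y - x) \<in> A"
      using mem_affine_3_minus[OF assms(1) u that assms(3)] .
    from dot[OF this] show ?thesis by simp
  qed
  then show ?thesis using assms(3) by (simp add: normal_cone_def)
qed

theorem theorem2p4:
  fixes A B :: "'a::{real_inner, complete_space} set"
    and z :: 'a
    and a b p q c :: "nat \<Rightarrow> 'a"
  assumes "closed A" and "convex A"
    and "closed B" and "convex B"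
    and "A \<inter> B \<noteq> {}"
    and "dykstra_seqs A B z a b p q"
    and "map_seq A B z c"
    and "z - proj_onto A z \<in> normal_cone A (proj_onto B (proj_onto A z)) \<or>
         (affine A \<and> proj_onto B (proj_onto A z) \<in> A)"
  shows "proj_onto (A \<inter> B) z = proj_onto B (proj_onto A z) \<and>
         (\<forall>n\<ge>1. b n = proj_onto (A \<inter> B) z) \<and>
         (\<forall>n\<ge>2. a n = proj_onto (A \<inter> B) z) \<and>
         (\<forall>n\<ge>1. c (2 * n - 1) = a n \<and> c (2 * n) = b n)"
proof -
  define y where "y = proj_onto A z"
  define x where "x = proj_onto B y"
  have "A \<noteq> {}" "B \<noteq> {}" using assms(5) by auto
  then have y: "z - y \<in> normal_cone A y" and qN: "y - x \<in> normal_cone B x"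
    using assms(1-4) by (auto simp: x_def y_def intro!: proj_onto_normal)
  have pN: "z - y \<in> normal_cone A x"
    using assms(8) normal_cone_affine[OF _ y, of x] by (auto simp: x_def y_def)
  \<comment> \<open>Membership is part of \<open>pN\<close> and \<open>qN\<close>, because a normal
    cone is empty off its set.\<close>
  have x: "x \<in> A" "x \<in> B" using pN qN by (auto simp: normal_cone_def split: if_splits)
  \<comment> \<open>The first equation drives Dykstra's iteration; the second, where the normal
    vector is 0, drives MAP.\<close>
  have PA: "proj_onto A (x + (z - y)) = x" "proj_onto A x = x"
    using pN x by (auto intro!: proj_onto_eqI simp: normal_cone_def)
  have PB: "proj_onto B (x + (y - x)) = x" "proj_onto B x = x"
    using qN x by (auto intro!: proj_onto_eqI simp: normal_cone_def)
  have "inner (z - x) (w - x) \<le> 0" if "w \<in> A \<inter> B" for w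
  proof -
    have "inner (z - y) (w - x) \<le> 0" "inner (y - x) (w - x) \<le> 0"
      using that pN qN x by (auto simp: normal_cone_def)
    then show ?thesis by (simp add: inner_diff_left)
  qed
  then have PAB: "proj_onto (A \<inter> B) z = x"
    using x by (intro proj_onto_eqI) (simp add: normal_cone_def)
  have D0: "b 0 = z" "p 0 = 0" "q 0 = 0"
    using assms(6) by (auto simp: dykstra_seqs_def)
  have D: "a (Suc n) = proj_onto A (b n + p n)" "p (Suc n) = b n + p n - a (Suc n)"
    "b (Suc n) = proj_onto B (a (Suc n) + q n)" "q (Suc n) = a (Suc n) + q n - b (Suc n)" for n
    using assms(6) unfolding dykstra_seqs_def by (metis One_nat_def diff_Suc_1 le_add1 plus_1_eq_Suc)+
  have M: "c (Suc (2 * n)) = proj_onto A (c (2 * n))"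
    "c (Suc (Suc (2 * n))) = proj_onto B (c (Suc (2 * n)))" for n
    using assms(7)[unfolded map_seq_def, THEN conjunct2, rule_format, of "Suc n"] by simp_all
  have a1: "a (Suc 0) = y" by (simp add: D D0 y_def)
  \<comment> \<open>The auxiliary terms belong to the invariant because the next projections are
    applied to \<open>x + (z - y)\<close> and \<open>x + (y - x)\<close>. It starts at index 1,
    since \<open>b 0\<close> is \<open>z\<close> and \<open>p 0\<close>, \<open>q 0\<close>
    vanish.\<close>
  have inv: "b (Suc n) = x \<and> p (Suc n) = z - y \<and> q (Suc n) = y - x" for n
  proof (induction n)
    case 0
    show ?case using D[of 0] by (simp add: D0 a1 x_def)
  next
    case (Suc n)
    have "a (Suc (Suc n)) = x" using Suc PA by (simp add: D(1)[of "Suc n"])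
    then show ?case using Suc PB D[of "Suc n"] by simp
  qed
  have a2: "a (Suc (Suc n)) = x" for n using inv[of n] PA by (simp add: D(1)[of "Suc n"])
  have c1: "c (Suc 0) = y" using M[of 0] assms(7) by (simp add: y_def map_seq_def)
  have ceven: "c (Suc (Suc (2 * n))) = x" for n
  proof (induction n)
    case 0
    show ?case using M[of 0] c1 by (simp add: x_def)
  next
    case (Suc n)
    then show ?case using M[of "Suc n"] PA PB by simp
  qed
  \<comment> \<open>The first odd MAP term is \<open>y\<close>, as is \<open>a (Suc 0)\<close>; all
    later ones are \<open>x\<close>.\<close>
  have codd: "c (Suc (2 * n)) = a (Suc n)" for n
  proof (cases n)
    case 0
    then show ?thesis using c1 a1 by simp
  next
    case (Suc m)
    then show ?thesis using M(1)[of "Suc m"] ceven[of m] PA a2 by simp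
  qed
  have "b n = x" if "n \<ge> 1" for n using that inv by (cases n) auto
  moreover have "a n = x" if n: "n \<ge> 2" for n
  proof -
    from n obtain m where "n = Suc (Suc m)" by (metis add_2_eq_Suc le_Suc_ex)
    then show ?thesis using a2 by simp
  qed
  moreover have "c (2 * n - 1) = a n \<and> c (2 * n) = b n" if "n \<ge> 1" for n
    using that codd ceven inv by (cases n) auto
  ultimately show ?thesis using PAB by (simp add: x_def y_def)
qed

end
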